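(* Let $n\ge 1$ and let $\pi\in S_n$ be a permutation with inversion graph $G_\pi$. For every reduced word $w$ of $\pi$, the set $F(w)$ of edges created by first occurrences of letters in $w$ is a spanning forest of $G_\pi$.
   Context: Inversion graph: $G_\pi$ is the simple graph with vertex set $[n]=\{1,\dots,n\}$ (the values of $\pi$) in which values $a<b$ are adjacent if and only if $b$ appears to the left of $a$ in the one-line notation $\pi(1)\cdots\pi(n)$, i.e. $\pi^{-1}(b)<\pi^{-1}(a)$. Reduced words: with $s_i=(i,i+1)$ for $1\le i\le n-1$, a reduced word for $\pi$ is a sequence $w=i_1 i_2\cdots i_m$ with $\pi=s_{i_1}s_{i_2}\cdots s_{i_m}$ and $m=\ell(\pi)$ minimal among all such expressions. Products are composed from right to left, so multiplying on the right by $s_i$ swaps the entries in positions $i$ and $i+1$ of the one-line notation. Edges created by letters: set $\pi_t=s_{i_1}\cdots s_{i_t}$ for $0\le t\le m$, so $\pi_0$ is the identity and $\pi_m=\pi$. For $1\le t\le m$, let $a_t<b_t$ be the values in positions $i_t$ and $i_t+1$ of $\pi_{t-1}$ (in that order, as $w$ is reduced), and let $f_t=a_tb_t$ be the edge joining $a_t$ and $b_t$; this is the edge created by the $t$th letter. The $t$th letter is a first occurrence if $i_t\notin\{i_1,\dots,i_{t-1}\}$, and $F(w)=\{f_t : \text{the } t\text{th letter is a first occurrence}\}$. A spanning forest of a graph $G$ is an acyclic subgraph of $G$ on the vertex set $V(G)$ having the same connected components (as vertex sets) as $G$. *)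

theory Defs
  imports "HOL-Combinatorics.Permutations"
begin

text \<open>An edge is the two-element set of its endpoints.\<close>

record 'a ugraph =
  verts :: "'a set"
  edges :: "'a set set"

definition simple_graph :: "'a ugraph \<Rightarrow> bool" where
  "simple_graph G \<longleftrightarrow> finite (verts G) \<and> (\<forall>e\<in>edges G. e \<subseteq> verts G \<and> card e = 2)"

definition subgraph :: "'a ugraph \<Rightarrow> 'a ugraph \<Rightarrow> bool" where
  "subgraph H G \<longleftrightarrow> simple_graph H \<and> verts H \<subseteq> verts G \<and> edges H \<subseteq> edges G"

definition adjacent :: "'a ugraph \<Rightarrow> 'a \<Rightarrow> 'a \<Rightarrow> bool" where
  "adjacent G u v \<longleftrightarrow> {u, v} \<in> edges G"

definition components :: "'a ugraph \<Rightarrow> 'a set set" where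
  "components G = verts G // {(u, v). u \<in> verts G \<and> v \<in> verts G \<and> (adjacent G)\<^sup>*\<^sup>* u v}"

text \<open>A cycle is listed without repeating its starting vertex at the end.\<close>

definition is_cycle :: "'a ugraph \<Rightarrow> 'a list \<Rightarrow> bool" where
  "is_cycle G c \<longleftrightarrow> length c \<ge> 3 \<and> distinct c \<and> set c \<subseteq> verts G \<and>
     (\<forall>i. Suc i < length c \<longrightarrow> adjacent G (c ! i) (c ! Suc i)) \<and> adjacent G (last c) (hd c)"

definition acyclic_graph :: "'a ugraph \<Rightarrow> bool" where
  "acyclic_graph G \<longleftrightarrow> (\<nexists>c. is_cycle G c)"

definition spanning_forest :: "'a ugraph \<Rightarrow> 'a ugraph \<Rightarrow> bool" where
  "spanning_forest H G \<longleftrightarrow>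
     subgraph H G \<and> verts H = verts G \<and> acyclic_graph H \<and> components H = components G"

text \<open>A permutation of \<open>{1..n}\<close> is a function \<open>p\<close> with \<open>p permutes {1..n}\<close>; its one-line notation is
  \<open>p 1, \<dots>, p n\<close>, so \<open>inv p a\<close> is the position of the value \<open>a\<close>.\<close>

definition inversion_graph :: "nat \<Rightarrow> (nat \<Rightarrow> nat) \<Rightarrow> nat ugraph" where
  "inversion_graph n p =
     \<lparr>verts = {1..n},
      edges = {{a, b} | a b. a \<in> {1..n} \<and> b \<in> {1..n} \<and> a < b \<and> inv p b < inv p a}\<rparr>"

definition adj_transp :: "nat \<Rightarrow> nat \<Rightarrow> nat" where
  "adj_transp i = transpose i (Suc i)"

fun word_perm :: "nat list \<Rightarrow> nat \<Rightarrow> nat" where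
  "word_perm [] = id"
| "word_perm (i # w) = adj_transp i \<circ> word_perm w"

definition word_for :: "nat \<Rightarrow> (nat \<Rightarrow> nat) \<Rightarrow> nat list \<Rightarrow> bool" where
  "word_for n p w \<longleftrightarrow> set w \<subseteq> {1..<n} \<and> word_perm w = p"

definition reduced_word :: "nat \<Rightarrow> (nat \<Rightarrow> nat) \<Rightarrow> nat list \<Rightarrow> bool" where
  "reduced_word n p w \<longleftrightarrow> word_for n p w \<and> (\<forall>v. word_for n p v \<longrightarrow> length w \<le> length v)"

text \<open>Letters are indexed from \<open>0\<close>: the letter \<open>w ! t\<close> acts on the permutation
  \<open>word_perm (take t w)\<close> given by the \<open>t\<close> letters before it, and creates the edge between the
  two values in the positions it swaps.\<close>

definition created_edge :: "nat list \<Rightarrow> nat \<Rightarrow> nat set" where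
  "created_edge w t =
     {word_perm (take t w) (w ! t), word_perm (take t w) (Suc (w ! t))}"

definition first_occurrence :: "nat list \<Rightarrow> nat \<Rightarrow> bool" where
  "first_occurrence w t \<longleftrightarrow> t < length w \<and> w ! t \<notin> set (take t w)"

definition first_occurrence_edges :: "nat list \<Rightarrow> nat set set" where
  "first_occurrence_edges w = {created_edge w t | t. first_occurrence w t}"

end

theory Submission
  imports Defs
begin

text \<open>
  Write \<open>p\<close> for the permutation of a word \<open>w\<close> and \<open>S\<close> for its set of letters. Two independent
  facts combine.

  The first concerns arbitrary words. Let \<open>path_edges S\<close> be the subgraph of the path
  \<open>1 - 2 - \<dots> - n\<close> with an edge \<open>{i, i + 1}\<close> for each \<open>i \<in> S\<close>. Each letter of \<open>w\<close> swaps two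
  positions that are adjacent in this graph, so \<open>p x\<close> always lies in the same component as \<open>x\<close>
  (\<open>joined_word_perm\<close>). Hence the edge \<open>{p i, p (i + 1)}\<close> created by a further letter \<open>i\<close> joins
  the component of \<open>i\<close> to that of \<open>i + 1\<close>. If \<open>i\<close> is a repeated letter nothing changes; if it is
  new, these two components are different, since the path is cut between \<open>i\<close> and \<open>i + 1\<close>. So the
  first-occurrence edges have the same components as \<open>path_edges S\<close>
  (\<open>joined_first_occurrence_edges\<close>), and each of them joins two components of the graph of its
  predecessors, which makes every one of them a bridge (\<open>all_bridges_first_occurrence_edges\<close>) and
  rules out cycles. All other created edges stay inside those components as well
  (\<open>joined_created_edge\<close>).

  The second fact is that for a reduced word the created edges are exactly the edges of the
  inversion graph (\<open>edges_inversion_graph_word_perm\<close>). Multiplying by \<open>s\<^sub>i\<close> on the right toggles the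
  inversion status of one pair of values, namely the created edge. In a reduced word no edge is
  created twice, as both letters could otherwise be deleted (\<open>inj_on_created_edge_reduced\<close>); so
  each created edge is toggled once and ends up inverted.

  Together: the first-occurrence edges form a forest inside the inversion graph, and every edge
  of the inversion graph lies within a component of that forest.
\<close>

section \<open>Connectivity and bridges\<close>

definition joined :: "'a set set \<Rightarrow> 'a \<Rightarrow> 'a \<Rightarrow> bool" where
  "joined E = (\<lambda>u v. {u, v} \<in> E)\<^sup>*\<^sup>*"

lemma joined_refl [simp]: "joined E x x"
  by (simp add: joined_def)

lemma joined_edge: "{x, y} \<in> E \<Longrightarrow> joined E x y"
  by (auto simp: joined_def)

lemma joined_trans: "joined E x y \<Longrightarrow> joined E y z \<Longrightarrow> joined E x z"
  unfolding joined_def by (rule rtranclp_trans)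

lemma joined_sym: "joined E x y \<Longrightarrow> joined E y x"
  unfolding joined_def
  by (rule sympD[OF symp_rtranclp]) (auto simp: symp_def insert_commute)

lemma joined_if_edges_joined:
  assumes "joined E x y" and "\<And>u v. {u, v} \<in> E \<Longrightarrow> joined E' u v"
  shows "joined E' x y"
  using assms(1) unfolding joined_def[of E]
  by (induction rule: rtranclp_induct) (auto intro: joined_trans assms(2))

lemma joined_mono: "joined E x y \<Longrightarrow> E \<subseteq> E' \<Longrightarrow> joined E' x y"
  by (rule joined_if_edges_joined) (auto intro: joined_edge)

lemma joined_insertD:
  assumes "joined (insert {u, v} E) x y"
  shows "joined E x y \<or> joined E x u \<and> joined E v y \<or> joined E x v \<and> joined E u y"
  using assms unfolding joined_def[of "insert {u, v} E"]
proof (induction rule: rtranclp_induct)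
  case (step y z)
  from step.hyps(2) consider "{y, z} \<in> E" | "y = u" "z = v" | "y = v" "z = u"
    by (auto simp: doubleton_eq_iff)
  then show ?case
  proof cases
    case 1
    then show ?thesis using step.IH by (meson joined_edge joined_trans)
  qed (use step.IH in auto)
qed simp

text \<open>Only the components of its ends matter for the effect of a new edge on connectivity.\<close>

lemma joined_insert_le:
  assumes le: "\<And>x y. joined E x y \<Longrightarrow> joined E' x y"
    and "joined E' a a'" "joined E' b b'"
    and xy: "joined (insert {a, b} E) x y"
  shows "joined (insert {a', b'} E') x y"
  using xy
proof (rule joined_if_edges_joined)
  let ?E = "insert {a', b'} E'"
  have up: "joined E' x y \<Longrightarrow> joined ?E x y" for x y
    by (rule joined_mono) auto
  have "joined ?E a' b'"
    by (rule joined_edge) simp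
  then have ab: "joined ?E a b"
    using assms(2,3) up by (meson joined_sym joined_trans)
  fix u v assume "{u, v} \<in> insert {a, b} E"
  then show "joined ?E u v"
    using ab joined_sym[OF ab] le[OF joined_edge] up by (auto simp: doubleton_eq_iff)
qed

text \<open>A formulation of acyclicity that is stable under adding edges between components.\<close>

definition all_bridges :: "'a set set \<Rightarrow> bool" where
  "all_bridges E \<longleftrightarrow> (\<forall>x y. {x, y} \<in> E \<longrightarrow> \<not> joined (E - {{x, y}}) x y)"

text \<open>A detour around an old edge \<open>{x, y}\<close> has to use the new edge \<open>{u, v}\<close>; the rest of the
  detour together with \<open>{x, y}\<close> would then join \<open>u\<close> to \<open>v\<close> by old edges.\<close>

lemma all_bridges_insert:
  assumes E: "all_bridges E" and uv: "\<not> joined E u v"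
  shows "all_bridges (insert {u, v} E)"
  unfolding all_bridges_def
proof (intro allI impI notI)
  fix x y
  assume edge: "{x, y} \<in> insert {u, v} E"
    and detour: "joined (insert {u, v} E - {{x, y}}) x y"
  show False
  proof (cases "{x, y} = {u, v}")
    case True
    have "joined E x y"
      using detour by (rule joined_mono) (use True in auto)
    then show False
      using True uv joined_sym[of E x y] by (auto simp: doubleton_eq_iff)
  next
    case False
    let ?K = "E - {{x, y}}"
    have xy: "{x, y} \<in> E" using edge False by simp
    then have "\<not> joined ?K x y"
      using E by (simp add: all_bridges_def)
    moreover have "joined (insert {u, v} ?K) x y"
      using detour by (rule joined_mono) auto
    ultimately have "joined ?K x u \<and> joined ?K v y \<or> joined ?K x v \<and> joined ?K u y"
      using joined_insertD by metis
    then have "joined E x u \<and> joined E v y \<or> joined E x v \<and> joined E u y"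
      using joined_mono[OF _ Diff_subset] by metis
    then show False
      using joined_edge[OF xy] uv by (meson joined_sym joined_trans)
  qed
qed

text \<open>Going along a cycle from its first to its last vertex avoids the edge that closes it.\<close>

lemma acyclic_graph_if_all_bridges:
  assumes "all_bridges (edges G)"
  shows "acyclic_graph G"
  unfolding acyclic_graph_def
proof
  assume "\<exists>c. is_cycle G c"
  then obtain c where len: "length c \<ge> 3" and dist: "distinct c"
    and steps: "\<And>i. Suc i < length c \<Longrightarrow> {c ! i, c ! Suc i} \<in> edges G"
    and closing: "{last c, hd c} \<in> edges G"
    by (auto simp: is_cycle_def adjacent_def)
  have ends: "hd c = c ! 0" "last c = c ! (length c - 1)"
    using len by (auto simp: hd_conv_nth last_conv_nth simp flip: length_greater_0_conv)
  let ?E = "edges G - {{last c, hd c}}"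
  have "joined ?E (c ! 0) (c ! i)" if "i < length c" for i
    using that
  proof (induction i)
    case (Suc i)
    have index: "c ! j = c ! k \<longleftrightarrow> j = k" if "j < length c" "k < length c" for j k
      using dist that by (rule nth_eq_iff_index_eq)
    \<comment> \<open>As the cycle has length at least 3, its first and last vertex are not consecutive in the list.\<close>
    have "{c ! i, c ! Suc i} \<noteq> {last c, hd c}"
      using Suc.prems len index[of i 0] index[of "Suc i" 0] index[of "Suc i" "length c - 1"]
      unfolding ends doubleton_eq_iff by linarith
    then have "joined ?E (c ! i) (c ! Suc i)"
      using steps[OF Suc.prems] by (intro joined_edge) auto
    then show ?case
      using Suc by (meson joined_trans Suc_lessD)
  qed simp
  from this[of "length c - 1"] have "joined ?E (hd c) (last c)"
    using len by (simp add: ends)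
  then show False
    using assms closing joined_sym[of ?E "hd c" "last c"] by (simp add: all_bridges_def)
qed

lemma components_eqI:
  assumes "verts G = verts H" and "joined (edges G) = joined (edges H)"
  shows "components G = components H"
proof -
  have "adjacent K = (\<lambda>u v. {u, v} \<in> edges K)" for K :: "'a ugraph"
    by (intro ext) (simp add: adjacent_def)
  then show ?thesis
    using assms by (simp add: components_def joined_def)
qed

section \<open>Permutations of words\<close>

lemma word_perm_append: "word_perm (u @ v) = word_perm u \<circ> word_perm v"
  by (induction u) (auto simp: comp_assoc)

lemma word_perm_permutes:
  assumes "set w \<subseteq> {1..<n}"
  shows "word_perm w permutes {1..n}"
  using assms
proof (induction w)
  case Nil
  show ?case unfolding word_perm.simps by (rule permutes_id)
next
  case (Cons i w)
  then have "adj_transp i permutes {1..n}"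
    by (auto simp: adj_transp_def intro: permutes_swap_id)
  with Cons show ?case
    unfolding word_perm.simps by (intro permutes_compose) simp_all
qed

lemma bij_word_perm: "bij (word_perm w)"
proof (induction w)
  case Nil
  show ?case unfolding word_perm.simps by (rule bij_id)
next
  case (Cons i w)
  then show ?case
    unfolding word_perm.simps by (rule bij_comp) (simp add: adj_transp_def)
qed

lemma created_edge_append:
  "t < length u \<Longrightarrow> created_edge (u @ v) t = created_edge u t"
  by (simp add: created_edge_def nth_append)

lemma created_edge_split:
  "created_edge (u @ i # v) (length u) = {word_perm u i, word_perm u (Suc i)}"
  by (simp add: created_edge_def)

lemma first_occurrence_edges_snoc:
  "first_occurrence_edges (w @ [i]) =
     (if i \<in> set w then first_occurrence_edges w
      else insert {word_perm w i, word_perm w (Suc i)} (first_occurrence_edges w))"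
proof -
  have "first_occurrence (w @ [i]) t \<longleftrightarrow>
      first_occurrence w t \<or> t = length w \<and> i \<notin> set w" for t
    by (auto simp: first_occurrence_def nth_append less_Suc_eq)
  then have "first_occurrence_edges (w @ [i]) =
      {created_edge (w @ [i]) t | t. first_occurrence w t} \<union>
      {created_edge (w @ [i]) t | t. t = length w \<and> i \<notin> set w}"
    unfolding first_occurrence_edges_def by blast
  also have "{created_edge (w @ [i]) t | t. first_occurrence w t} = first_occurrence_edges w"
    unfolding first_occurrence_edges_def first_occurrence_def
    by (rule Collect_cong) (metis created_edge_append)
  finally show ?thesis
    by (auto simp: created_edge_split)
qed

section \<open>Components of the first-occurrence edges\<close>

definition path_edges :: "nat set \<Rightarrow> nat set set" where
  "path_edges S = {{i, Suc i} | i. i \<in> S}"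

lemma path_edges_insert: "path_edges (insert i S) = insert {i, Suc i} (path_edges S)"
  by (auto simp: path_edges_def)

lemma joined_path_edges_Suc: "i \<in> S \<Longrightarrow> joined (path_edges S) i (Suc i)"
  by (rule joined_edge) (auto simp: path_edges_def)

text \<open>Every other edge of the path stays on one side of the cut between \<open>i\<close> and \<open>i + 1\<close>.\<close>

lemma not_joined_path_edges:
  assumes "i \<notin> S"
  shows "\<not> joined (path_edges S) i (Suc i)"
proof
  have "y \<le> i" if "joined (path_edges S) i y" for y
    using that unfolding joined_def
  proof (induction rule: rtranclp_induct)
    case (step y z)
    then obtain j where j: "j \<in> S" "{y, z} = {j, Suc j}"
      by (auto simp: path_edges_def)
    then have "j \<noteq> i" using assms by auto
    with j step.IH show ?case by (auto simp: doubleton_eq_iff)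
  qed simp
  then show "joined (path_edges S) i (Suc i) \<Longrightarrow> False" by force
qed

lemma joined_word_perm:
  assumes "set w \<subseteq> S"
  shows "joined (path_edges S) (word_perm w x) x"
  using assms
proof (induction w arbitrary: x)
  case (Cons i w)
  have "joined (path_edges S) (adj_transp i y) y" for y
    using Cons.prems joined_path_edges_Suc[of i S] joined_sym[OF joined_path_edges_Suc[of i S]]
    by (auto simp: adj_transp_def transpose_def)
  then show ?case
    using Cons joined_trans by fastforce
qed simp

lemma joined_created_edge:
  assumes "t < length w"
  shows "\<exists>a b. created_edge w t = {a, b} \<and> joined (path_edges (set w)) a b"
proof -
  let ?p = "word_perm (take t w)"
  have "joined (path_edges (set w)) (?p x) x" for x
    by (rule joined_word_perm) (rule set_take_subset)
  moreover have "joined (path_edges (set w)) (w ! t) (Suc (w ! t))"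
    using assms by (simp add: joined_path_edges_Suc)
  ultimately have "joined (path_edges (set w)) (?p (w ! t)) (?p (Suc (w ! t)))"
    by (meson joined_sym joined_trans)
  then show ?thesis
    by (auto simp: created_edge_def)
qed

text \<open>The graph of first-occurrence edges changes with \<open>w\<close> in a way that is hard to see directly, but
  up to connectivity the edge \<open>{p i, p (i + 1)}\<close> may be replaced by \<open>{i, i + 1}\<close>.\<close>

lemma joined_first_occurrence_edges:
  "joined (first_occurrence_edges w) = joined (path_edges (set w))"
proof (induction w rule: rev_induct)
  case Nil
  then show ?case
    by (simp add: first_occurrence_edges_def first_occurrence_def path_edges_def)
next
  case (snoc i w)
  show ?case
  proof (cases "i \<in> set w")
    case True
    with snoc show ?thesis
      by (simp add: first_occurrence_edges_snoc insert_absorb)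
  next
    case False
    let ?F = "first_occurrence_edges w" and ?P = "path_edges (set w)"
    let ?a = "word_perm w i" and ?b = "word_perm w (Suc i)"
    have ab: "joined ?P ?a i" "joined ?P ?b (Suc i)"
      by (simp_all add: joined_word_perm)
    have ba: "joined ?F i ?a" "joined ?F (Suc i) ?b"
      unfolding snoc by (rule ab[THEN joined_sym])+
    have "joined (insert {?a, ?b} ?F) x y \<longleftrightarrow> joined (insert {i, Suc i} ?P) x y" for x y
      using joined_insert_le[OF _ ab, of ?F x y] joined_insert_le[OF _ ba, of ?P x y] snoc
      by auto
    then show ?thesis
      using False by (auto simp: first_occurrence_edges_snoc path_edges_insert)
  qed
qed

lemma all_bridges_first_occurrence_edges: "all_bridges (first_occurrence_edges w)"
proof (induction w rule: rev_induct)
  case Nil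
  then show ?case
    by (simp add: first_occurrence_edges_def first_occurrence_def all_bridges_def)
next
  case (snoc i w)
  have "\<not> joined (first_occurrence_edges w) (word_perm w i) (word_perm w (Suc i))"
    if "i \<notin> set w"
    using not_joined_path_edges[OF that] joined_word_perm[OF order_refl]
    by (metis joined_first_occurrence_edges joined_sym joined_trans)
  with snoc show ?case
    by (auto simp: first_occurrence_edges_snoc intro: all_bridges_insert)
qed

section \<open>Created edges of a reduced word\<close>

text \<open>If the edge created by \<open>i\<close> after \<open>u\<close> is created again by \<open>j\<close> after \<open>u i v\<close>, then appending
  \<open>j\<close> multiplies by the same transposition of values as inserting \<open>i\<close> does, and the two cancel.\<close>

lemma word_perm_delete_two:
  assumes "created_edge (u @ i # v @ j # x) (length u) =
    created_edge (u @ i # v @ j # x) (length (u @ i # v))"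
  shows "word_perm (u @ i # v @ j # x) = word_perm (u @ v @ x)"
proof -
  let ?p = "word_perm u" and ?q = "word_perm (u @ i # v)"
  \<comment> \<open>Moving the adjacent transposition to the left turns it into a transposition of values.\<close>
  have move: "word_perm y \<circ> adj_transp k =
      transpose (word_perm y k) (word_perm y (Suc k)) \<circ> word_perm y" for y k
    unfolding adj_transp_def using bij_word_perm[of y]
    by (auto simp: fun_eq_iff transpose_def bij_def inj_eq)
  have "{?p i, ?p (Suc i)} = {?q j, ?q (Suc j)}"
    using assms created_edge_split[of u i "v @ j # x"]
      created_edge_split[of "u @ i # v" j x] by simp
  then have tr: "transpose (?q j) (?q (Suc j)) = transpose (?p i) (?p (Suc i))"
    by (auto simp: doubleton_eq_iff transpose_commute)
  have q: "?q = transpose (?p i) (?p (Suc i)) \<circ> (?p \<circ> word_perm v)"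
    using move[of u i] by (simp add: word_perm_append fun_eq_iff)
  have "?q \<circ> adj_transp j = ?p \<circ> word_perm v"
    unfolding move tr by (subst q) (simp add: fun_eq_iff)
  then show ?thesis
    by (simp add: word_perm_append fun_eq_iff)
qed

lemma inj_on_created_edge_reduced:
  assumes "reduced_word n p w"
  shows "inj_on (created_edge w) {..<length w}"
proof (rule linorder_inj_onI')
  fix s t
  assume "s \<in> {..<length w}" "t \<in> {..<length w}" "s < t"
  then have st: "s < t" "t < length w" by auto
  define u v x where "u = take s w" and "v = take (t - Suc s) (drop (Suc s) w)"
    and "x = drop (Suc t) w"
  have "drop (Suc s) w = v @ drop (t - Suc s) (drop (Suc s) w)"
    unfolding v_def by (rule append_take_drop_id[symmetric])
  also have "drop (t - Suc s) (drop (Suc s) w) = w ! t # x"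
    using st by (simp add: x_def Cons_nth_drop_Suc)
  finally have w: "w = u @ w ! s # v @ w ! t # x"
    using st id_take_nth_drop[of s w] by (simp add: u_def)
  have len: "length u = s" "length (u @ w ! s # v) = t"
    using st by (auto simp: u_def v_def)
  show "created_edge w s \<noteq> created_edge w t"
  proof
    assume "created_edge w s = created_edge w t"
    then have "word_perm w = word_perm (u @ v @ x)"
      using word_perm_delete_two[of u "w ! s" v "w ! t" x] w len by simp
    moreover have "set w \<supseteq> set (u @ v @ x)"
      by (subst w) auto
    ultimately have "word_for n p (u @ v @ x)"
      using assms by (auto simp: reduced_word_def word_for_def)
    then have "length w \<le> length (u @ v @ x)"
      using assms unfolding reduced_word_def by blast
    moreover have "length w = length (u @ v @ x) + 2"
      by (subst w) simp
    ultimately show False by simp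
  qed
qed

lemma adj_transp_less_iff:
  assumes "x \<noteq> y"
  shows "adj_transp i x < adj_transp i y \<longleftrightarrow> (if {x, y} = {i, Suc i} then y < x else x < y)"
  using assms by (auto simp: adj_transp_def transpose_def doubleton_eq_iff)

text \<open>Swapping two neighbouring positions changes the relative order of the two values there and of
  no other pair. As these values are not yet inverted, the swap adds their edge and removes none.\<close>

lemma edges_inversion_graph_comp_adj_transp:
  assumes p: "p permutes {1..n}" and i: "i \<in> {1..<n}"
    and new: "{p i, p (Suc i)} \<notin> edges (inversion_graph n p)"
  shows "edges (inversion_graph n (p \<circ> adj_transp i)) =
    insert {p i, p (Suc i)} (edges (inversion_graph n p))"
proof -
  let ?f = "{p i, p (Suc i)}" and ?q = "p \<circ> adj_transp i"
  have in_edges: "{a, b} \<in> edges (inversion_graph n r) \<longleftrightarrow> inv r b < inv r a"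
    if "a \<in> {1..n}" "b \<in> {1..n}" "a < b" for a b r
    using that by (fastforce simp: inversion_graph_def doubleton_eq_iff)
  have bij: "bij p" using p by (rule permutes_bij)
  have inv_q: "inv ?q = adj_transp i \<circ> inv p"
    using bij by (simp add: o_inv_distrib adj_transp_def)
  have f_iff: "{inv p a, inv p b} = {i, Suc i} \<longleftrightarrow> {a, b} = ?f" for a b
    using bij_inv_eq_iff[OF bij] unfolding doubleton_eq_iff by metis
  have toggle: "{a, b} \<in> edges (inversion_graph n ?q) \<longleftrightarrow>
      {a, b} \<in> insert ?f (edges (inversion_graph n p))"
    if ab: "a \<in> {1..n}" "b \<in> {1..n}" "a < b" for a b
  proof -
    have ne: "inv p b \<noteq> inv p a"
      using ab bij by (metis bij_inv_eq_iff less_irrefl)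
    show ?thesis
    proof (cases "{a, b} = ?f")
      case True
      then have "\<not> inv p b < inv p a"
        using new in_edges[OF ab] by metis
      then show ?thesis
        using True f_iff[of b a] ne in_edges[OF ab, of ?q] adj_transp_less_iff[OF ne, of i]
        by (auto simp: inv_q insert_commute)
    next
      case False
      then show ?thesis
        using f_iff[of b a] in_edges[OF ab] adj_transp_less_iff[OF ne, of i]
        by (auto simp: inv_q insert_commute)
    qed
  qed
  have shape: "\<exists>a b. e = {a, b} \<and> a \<in> {1..n} \<and> b \<in> {1..n} \<and> a < b"
    if "e \<in> edges (inversion_graph n ?q) \<or> e \<in> insert ?f (edges (inversion_graph n p))" for e
  proof (cases "e = ?f")
    case True
    have "p i \<in> {1..n}" "p (Suc i) \<in> {1..n}"
      using i by (auto simp only: permutes_in_image[OF p]) auto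
    moreover have "p i \<noteq> p (Suc i)"
      using bij by (simp add: bij_def inj_eq)
    ultimately show ?thesis
      using True by (metis insert_commute linorder_neqE_nat)
  next
    case False
    with that show ?thesis by (auto simp: inversion_graph_def)
  qed
  show ?thesis
  proof (rule set_eqI)
    fix e
    show "e \<in> edges (inversion_graph n ?q) \<longleftrightarrow>
        e \<in> insert ?f (edges (inversion_graph n p))"
      using toggle shape[of e] by metis
  qed
qed

lemma edges_inversion_graph_word_perm:
  assumes "set w \<subseteq> {1..<n}" and "inj_on (created_edge w) {..<length w}"
  shows "edges (inversion_graph n (word_perm w)) = created_edge w ` {..<length w}"
  using assms
proof (induction w rule: rev_induct)
  case Nil
  then show ?case
    by (auto simp: inversion_graph_def)
next
  case (snoc i w)
  let ?f = "{word_perm w i, word_perm w (Suc i)}"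
  have old: "created_edge (w @ [i]) t = created_edge w t" if "t \<in> {..<length w}" for t
    using that by (simp add: created_edge_append)
  have last: "created_edge (w @ [i]) (length w) = ?f"
    by (simp add: created_edge_split)
  have img: "created_edge (w @ [i]) ` {..<length w} = created_edge w ` {..<length w}"
    using old by (rule image_cong[OF refl])
  have "inj_on (created_edge (w @ [i])) (insert (length w) {..<length w})"
    using snoc.prems(2) by (simp add: lessThan_Suc)
  then have inj: "inj_on (created_edge (w @ [i])) {..<length w}"
    and new: "?f \<notin> created_edge w ` {..<length w}"
    using last img by auto
  have "inj_on (created_edge w) {..<length w}"
    using inj by (simp add: inj_on_def old)
  with snoc have IH:
    "edges (inversion_graph n (word_perm w)) = created_edge w ` {..<length w}"
    by simp
  have "edges (inversion_graph n (word_perm w \<circ> adj_transp i)) =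
      insert ?f (created_edge w ` {..<length w})"
    using snoc.prems(1) new edges_inversion_graph_comp_adj_transp[OF word_perm_permutes, of w n i]
    by (simp add: IH)
  moreover have "word_perm (w @ [i]) = word_perm w \<circ> adj_transp i"
    by (simp add: word_perm_append fun_eq_iff)
  ultimately show ?case
    using img last by (simp add: lessThan_Suc del: o_apply)
qed

section \<open>The spanning forest\<close>

theorem proposition3p2:
  fixes n :: nat and \<pi> :: "nat \<Rightarrow> nat" and w :: "nat list"
  assumes "n \<ge> 1"
    and "\<pi> permutes {1..n}"
    and "reduced_word n \<pi> w"
  shows "spanning_forest \<lparr>verts = {1..n}, edges = first_occurrence_edges w\<rparr> (inversion_graph n \<pi>)"
proof -
  let ?F = "first_occurrence_edges w" and ?E = "edges (inversion_graph n \<pi>)"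
  let ?H = "\<lparr>verts = {1..n}, edges = ?F\<rparr>"
  have w: "set w \<subseteq> {1..<n}" "word_perm w = \<pi>"
    using assms(3) by (auto simp: reduced_word_def word_for_def)
  have E: "?E = created_edge w ` {..<length w}"
    using edges_inversion_graph_word_perm[OF w(1) inj_on_created_edge_reduced[OF assms(3)]] w(2)
    by simp
  have FE: "?F \<subseteq> ?E"
    unfolding E by (auto simp: first_occurrence_edges_def first_occurrence_def)
  have V: "verts (inversion_graph n \<pi>) = {1..n}"
    by (simp add: inversion_graph_def)
  have "e \<subseteq> {1..n} \<and> card e = 2" if "e \<in> ?E" for e
    using that by (auto simp: inversion_graph_def)
  then have sub: "subgraph ?H (inversion_graph n \<pi>)"
    using FE V by (auto simp: subgraph_def simple_graph_def)
  have edges_joined: "joined ?F u v" if "{u, v} \<in> ?E" for u v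
  proof -
    from that obtain t where t: "t < length w" "{u, v} = created_edge w t"
      unfolding E by auto
    then obtain a b where "{u, v} = {a, b}" "joined ?F a b"
      using joined_created_edge[OF t(1)] joined_first_occurrence_edges by metis
    then show ?thesis
      using joined_sym by (auto simp: doubleton_eq_iff)
  qed
  have "joined ?F = joined ?E"
    using joined_mono[OF _ FE] joined_if_edges_joined[OF _ edges_joined] by blast
  then have "components ?H = components (inversion_graph n \<pi>)"
    by (intro components_eqI) (simp_all add: V)
  then show ?thesis
    using sub V acyclic_graph_if_all_bridges[of ?H] all_bridges_first_occurrence_edges[of w]
    by (simp add: spanning_forest_def)
qed

end
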